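(* Fix an integer $k\ge 1$. For every integer $n\ge 0$, the number of partitions of $n$ satisfying condition (P) equals the number of partitions of $n$ satisfying condition (S), where: (P) every part is either even or $\equiv -3 \pmod{2k+6}$. (S) all of the following hold: - the difference between adjacent parts is never $1$; - an odd part $2j+1$ is never immediately adjacent to any of the $k$ even numbers $2j-2,2j-4,\dots,2j-2k$; - (initial condition, implied by a fictitious zero) the smallest part is not equal to any of $1,3,\dots,2k+1$. Moreover, the generating function of the partitions satisfying (P) is the periodic infinite product $\prod_m (1-q^m)^{-1}$ over all $m\ge1$ with $m$ even or $m\equiv -3\pmod{2k+6}$; and a partition satisfies (S) if and only if its conjugate satisfies the following condition (C): (C) both of the following hold: - no part appears exactly once; - if a part appears exactly $3$, $5$, $\dots$, or $2k+1$ times, then there are an odd number of parts strictly greater than it.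
   Context: Partitions $\lambda=(\lambda_1\ge\lambda_2\ge\dots\ge\lambda_r)$ have positive integer parts. Two parts are (immediately) adjacent if they are $\lambda_i,\lambda_{i+1}$ for some $1\le i<r$. The initial condition is "implied by a fictitious zero" if it is what the difference/adjacency conditions impose when one part equal to $0$ is appended to the partition. Numbers of parts are counted with multiplicity. The conjugate of a partition is obtained by transposing its Ferrers diagram. *)

theory Defs
  imports "HOL-Analysis.Analysis" "HOL-Number_Theory.Cong"
begin

text \<open>Partitions are weakly decreasing lists of positive parts; the empty list is the
  partition of 0.\<close>

definition is_partition :: "nat list \<Rightarrow> bool" where
  "is_partition xs \<longleftrightarrow> sorted_wrt (\<ge>) xs \<and> (\<forall>p\<in>set xs. 0 < p)"

definition partitions :: "nat \<Rightarrow> nat list set" where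
  "partitions n = {xs. is_partition xs \<and> sum_list xs = n}"

lemma finite_partitions: "finite (partitions n)"
proof (rule finite_subset)
  show "finite {xs. set xs \<subseteq> {..n} \<and> length xs \<le> n}"
    by (rule finite_lists_length_le) simp
  have "length xs \<le> sum_list xs" if "\<forall>p\<in>set xs. 0 < p" for xs :: "nat list"
    using that by (induction xs) force+
  then show "partitions n \<subseteq> {xs. set xs \<subseteq> {..n} \<and> length xs \<le> n}"
    by (auto simp: partitions_def is_partition_def intro: member_le_sum_list)
qed

definition ferrers :: "nat list \<Rightarrow> (nat \<times> nat) set" where
  "ferrers xs = {(i, j). i < length xs \<and> j < xs ! i}"

text \<open>The parts of the conjugate are the lengths of the nonempty columns of the Ferrers diagram.\<close>

definition conjugate :: "nat list \<Rightarrow> nat list" where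
  "conjugate xs = map (\<lambda>j. card {i. (i, j) \<in> ferrers xs}) [0..<Max (insert 0 (set xs))]"

lemma
  assumes "is_partition xs"
  shows is_partition_conjugate: "is_partition (conjugate xs)"
    and ferrers_conjugate: "ferrers (conjugate xs) = (ferrers xs)\<inverse>"
proof -
  define c where "c j = {i. (i, j) \<in> ferrers xs}" for j
  define M where "M = Max (insert 0 (set xs))"
  have conj: "conjugate xs = map (\<lambda>j. card (c j)) [0..<M]"
    by (simp add: conjugate_def c_def M_def)
  have c: "i \<in> c j \<longleftrightarrow> i < length xs \<and> j < xs ! i" for i j
    by (simp add: c_def ferrers_def)
  have fin: "finite (c j)" for j
    by (rule finite_subset[of _ "{..<length xs}"]) (auto simp: c)
  have anti: "card (c j') \<le> card (c j)" if "j \<le> j'" for j j'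
    using that by (intro card_mono fin) (auto simp: c)
  have down: "i \<in> c j" if "i' \<in> c j" "i \<le> i'" for i i' j
  proof -
    have "xs ! i' \<le> xs ! i"
      using that assms by (cases "i = i'") (auto simp: c is_partition_def sorted_wrt_iff_nth_less)
    with that show ?thesis by (auto simp: c)
  qed
  have mem: "i \<in> c j \<longleftrightarrow> i < card (c j)" for i j
  proof
    assume "i \<in> c j"
    then have "{..i} \<subseteq> c j" using down by auto
    from card_mono[OF fin this] show "i < card (c j)" by simp
  next
    assume *: "i < card (c j)"
    show "i \<in> c j"
    proof (rule ccontr)
      assume "i \<notin> c j"
      then have "c j \<subseteq> {..<i}" using down by (meson lessThan_iff linorder_not_less subsetI)
      from card_mono[OF _ this] * show False by simp
    qed
  qed
  have le_M: "xs ! i \<le> M" if "i < length xs" for i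
    using that by (simp add: M_def)
  have pos: "0 < card (c j)" if "j < M" for j
  proof -
    have "M \<in> insert 0 (set xs)" unfolding M_def by (rule Max_in) auto
    with that have "M \<in> set xs" by auto
    then obtain i where "i < length xs" "xs ! i = M" by (auto simp: in_set_conv_nth)
    with that have "i \<in> c j" by (simp add: c)
    then show ?thesis using fin card_gt_0_iff by blast
  qed
  show "is_partition (conjugate xs)"
    using pos anti by (auto simp: is_partition_def conj sorted_wrt_iff_nth_less)
  have "(j, i) \<in> ferrers (conjugate xs) \<longleftrightarrow> (i, j) \<in> ferrers xs" for i j
  proof -
    have "(j, i) \<in> ferrers (conjugate xs) \<longleftrightarrow> j < M \<and> i \<in> c j"
      by (auto simp: ferrers_def conj mem)
    also have "\<dots> \<longleftrightarrow> (i, j) \<in> ferrers xs"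
      using le_M[of i] by (auto simp: c ferrers_def)
    finally show ?thesis .
  qed
  then show "ferrers (conjugate xs) = (ferrers xs)\<inverse>" by auto
qed

text \<open>In the following, \<open>adjacent xs a b\<close> lists the earlier, that is the larger, part first.\<close>

definition adjacent :: "nat list \<Rightarrow> nat \<Rightarrow> nat \<Rightarrow> bool" where
  "adjacent xs a b \<longleftrightarrow> (\<exists>i. Suc i < length xs \<and> a = xs ! i \<and> b = xs ! Suc i)"

definition P_part :: "nat \<Rightarrow> nat \<Rightarrow> bool" where
  "P_part k m \<longleftrightarrow> even m \<or> [int m = - 3] (mod int (2 * k + 6))"

definition cond_P :: "nat \<Rightarrow> nat list \<Rightarrow> bool" where
  "cond_P k xs \<longleftrightarrow> (\<forall>p\<in>set xs. P_part k p)"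

definition S_adjacency :: "nat \<Rightarrow> nat list \<Rightarrow> bool" where
  "S_adjacency k xs \<longleftrightarrow>
     (\<forall>a b. adjacent xs a b \<longrightarrow> int a - int b \<noteq> 1) \<and>
     (\<forall>j b. adjacent xs (2 * j + 1) b \<longrightarrow> (\<forall>l\<in>{1..k}. int b \<noteq> 2 * int j - 2 * int l))"

definition S_initial :: "nat \<Rightarrow> nat list \<Rightarrow> bool" where
  "S_initial k xs \<longleftrightarrow> (xs \<noteq> [] \<longrightarrow> Min (set xs) \<notin> {2 * i + 1 | i. i \<le> k})"

definition cond_S :: "nat \<Rightarrow> nat list \<Rightarrow> bool" where
  "cond_S k xs \<longleftrightarrow> S_adjacency k xs \<and> S_initial k xs"

definition cond_C :: "nat \<Rightarrow> nat list \<Rightarrow> bool" where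
  "cond_C k xs \<longleftrightarrow>
     (\<forall>p\<in>set xs. count_list xs p \<noteq> 1) \<and>
     (\<forall>p\<in>set xs. count_list xs p \<in> {2 * i + 1 | i. 1 \<le> i \<and> i \<le> k} \<longrightarrow>
        odd (length (filter (\<lambda>x. p < x) xs)))"

end

theory Submission
  imports Defs "HOL-Library.Multiset"
begin

text \<open>Conjugation turns (S) into (C): the multiplicity of \<open>i + 1\<close> in the conjugate is the \<open>i\<close>-th
  difference of the original parts, and the number of conjugate parts exceeding \<open>i + 1\<close> is the part
  that follows. So it remains to compare (C) with (P).

  Let \<open>x\<^sub>1 > x\<^sub>2 > \<dots> > x\<^sub>s\<close> be the parts of odd multiplicity in a partition. The number of parts
  exceeding \<open>x\<^sub>i\<close> has the parity of \<open>i - 1\<close>, so (C) says that the multiplicity of \<open>x\<^sub>i\<close> is at least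
  \<open>2 k + 3\<close> for odd \<open>i\<close> and at least \<open>3\<close> for even \<open>i\<close>. Taking off \<open>2 k + 3\<close> or \<open>3\<close> copies leaves
  arbitrary even multiplicities. Hence the partitions with (C) are the pairs of a multiset \<open>M\<close> and a
  strict partition \<open>x\<close>, of size \<open>2 |M| + (2 k + 3) (x\<^sub>1 + x\<^sub>3 + \<dots>) + 3 (x\<^sub>2 + x\<^sub>4 + \<dots>)\<close>
  (\<open>bij_betw_C_mset\<close>).

  The partitions with (P) are the pairs of a multiset \<open>M\<close> of halved even parts and a partition \<open>z\<close>
  whose parts \<open>m\<close> stand for the odd parts \<open>(2 k + 6) m - 3\<close> (\<open>bij_betw_P_mset\<close>). The sizes agree if
  \<open>|z| = x\<^sub>1 + x\<^sub>3 + \<dots>\<close> and \<open>z\<close> has \<open>x\<^sub>1 - x\<^sub>2 + x\<^sub>3 - \<dots>\<close> parts. A bijection \<open>x \<mapsto> z\<close> with these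
  properties (\<open>bij_betw_frob\<close>, \<open>alt_weight_frob\<close>) comes from Frobenius symbols: if \<open>a\<^sub>i\<close> denotes the
  alternating sum \<open>x\<^sub>i - x\<^sub>i\<^sub>+\<^sub>1 + \<dots>\<close>, then strictness of \<open>x\<close> amounts to \<open>a\<^sub>1 > a\<^sub>3 > \<dots>\<close> and
  \<open>a\<^sub>2 > a\<^sub>4 > \<dots>\<close>, and the numbers \<open>a\<^sub>1 - 1, a\<^sub>3 - 1, \<dots>\<close> and \<open>a\<^sub>2, a\<^sub>4, \<dots>\<close> are the legs and arms in
  the Frobenius symbol of \<open>z\<close>.\<close>

section \<open>Euler products\<close>

lemma partitions_0: "partitions 0 = {[]}"
proof -
  have "xs = []" if "is_partition xs" "sum_list xs = 0" for xs
    using that by (cases xs) (auto simp: is_partition_def)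
  then show ?thesis by (auto simp: partitions_def is_partition_def)
qed

text \<open>The largest part is the head of the list, so either it is \<open>Suc N\<close> and can be
  removed, or all parts are at most \<open>N\<close>.\<close>

lemma partitions_le_Suc:
  assumes "Q (Suc N)"
  shows "{xs \<in> partitions n. \<forall>p\<in>set xs. Q p \<and> p \<le> Suc N} =
    {xs \<in> partitions n. \<forall>p\<in>set xs. Q p \<and> p \<le> N} \<union>
    (if n < Suc N then {} else
      (#) (Suc N) ` {xs \<in> partitions (n - Suc N). \<forall>p\<in>set xs. Q p \<and> p \<le> Suc N})"
    (is "?L = ?A \<union> ?B")
proof (rule set_eqI)
  fix xs
  show "xs \<in> ?L \<longleftrightarrow> xs \<in> ?A \<union> ?B"
  proof (cases "xs \<noteq> [] \<and> hd xs = Suc N")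
    case True
    then obtain ys where xs: "xs = Suc N # ys" by (cases xs) auto
    have "sum_list xs = n \<longleftrightarrow> \<not> n < Suc N \<and> sum_list ys = n - Suc N"
      by (auto simp: xs)
    then show ?thesis using assms
      by (auto simp: xs partitions_def is_partition_def)
  next
    case False
    have "(\<forall>p\<in>set xs. Q p \<and> p \<le> Suc N) \<longleftrightarrow> (\<forall>p\<in>set xs. Q p \<and> p \<le> N)"
      if "is_partition xs"
    proof (cases xs)
      case (Cons y ys)
      then show ?thesis using False that
        by (force simp: is_partition_def le_Suc_eq)
    qed simp
    moreover have "xs \<notin> ?B" using False by auto
    ultimately show ?thesis by (auto simp: partitions_def)
  qed
qed

text \<open>By \<open>partitions_le_Suc\<close>, the product over \<open>m \<le> N\<close> generates the partitions with parts at
  most \<open>N\<close>; its coefficient of order \<open>n\<close> is constant from \<open>N = n\<close> on.\<close>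

lemma has_prod_partitions:
  fixes Q :: "nat \<Rightarrow> bool"
  shows "(\<lambda>m. if m \<ge> 1 \<and> Q m then inverse (1 - fps_X ^ m) else 1) has_prod
    (Abs_fps (\<lambda>n. of_nat (card {xs \<in> partitions n. \<forall>p\<in>set xs. Q p})) :: rat fps)"
proof -
  define f :: "nat \<Rightarrow> rat fps"
    where "f = (\<lambda>m. if m \<ge> 1 \<and> Q m then inverse (1 - fps_X ^ m) else 1)"
  define R where "R N n = {xs \<in> partitions n. \<forall>p\<in>set xs. Q p \<and> p \<le> N}" for N n
  define G :: "nat \<Rightarrow> rat fps" where "G N = Abs_fps (\<lambda>n. of_nat (card (R N n)))" for N
  define H :: "rat fps"
    where "H = Abs_fps (\<lambda>n. of_nat (card {xs \<in> partitions n. \<forall>p\<in>set xs. Q p}))"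
  have fin: "finite (R N n)" for N n
    unfolding R_def using finite_partitions by simp
  have part: "(\<Prod>i\<le>N. f i) = G N" for N
  proof (induction N)
    case 0
    have "R 0 n = (if n = 0 then {[]} else {})" for n
    proof -
      have "xs = []" if "is_partition xs" "\<forall>p\<in>set xs. p = 0" for xs
        using that by (cases xs) (auto simp: is_partition_def)
      then have "R 0 n = {xs. xs = [] \<and> n = 0}"
        unfolding R_def partitions_def by (auto simp: is_partition_def)
      then show ?thesis by auto
    qed
    then show ?case by (auto simp: f_def G_def fps_eq_iff)
  next
    case (Suc N)
    show ?case
    proof (cases "Q (Suc N)")
      case False
      then have "R (Suc N) n = R N n" for n
        by (auto simp: R_def le_Suc_eq)
      then show ?thesis using False Suc by (simp add: f_def G_def)
    next
      case True
      have rec: "card (R (Suc N) n) =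
        card (R N n) + (if n < Suc N then 0 else card (R (Suc N) (n - Suc N)))" for n
      proof -
        let ?B = "if n < Suc N then {} else (#) (Suc N) ` R (Suc N) (n - Suc N)"
        have "R (Suc N) n = R N n \<union> ?B"
          unfolding R_def by (rule partitions_le_Suc) (rule True)
        moreover have "R N n \<inter> ?B = {}" by (auto simp: R_def)
        moreover have "card ?B = (if n < Suc N then 0 else card (R (Suc N) (n - Suc N)))"
          by (auto intro!: card_image)
        ultimately show ?thesis using fin by (simp add: card_Un_disjoint)
      qed
      have eq: "G N = G (Suc N) * (1 - fps_X ^ Suc N)"
      proof (rule fps_ext)
        fix n
        show "fps_nth (G N) n = fps_nth (G (Suc N) * (1 - fps_X ^ Suc N)) n"
          using rec[of n]
          by (simp add: G_def right_diff_distrib fps_X_power_mult_right_nth del: power_Suc)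
      qed
      have "(1 - fps_X ^ Suc N) * inverse (1 - fps_X ^ Suc N) = (1 :: rat fps)"
        by (subst mult.commute, rule inverse_mult_eq_1) simp
      then have "G (Suc N) = G N * inverse (1 - fps_X ^ Suc N)"
        unfolding eq by (simp only: mult.assoc mult_1_right)
      then show ?thesis using True Suc by (simp add: f_def)
    qed
  qed
  have "(\<lambda>N. \<Prod>i\<le>N. f i) \<longlonglongrightarrow> H"
  proof (rule tendsto_fpsI)
    fix n
    show "eventually (\<lambda>N. fps_nth (\<Prod>i\<le>N. f i) n = fps_nth H n) sequentially"
    proof (rule eventually_mono[OF eventually_ge_at_top[of n]])
      fix N assume "n \<le> N"
      have "p \<le> n" if "xs \<in> partitions n" "p \<in> set xs" for xs p
        using that member_le_sum_list[of p xs] by (auto simp: partitions_def)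
      with \<open>n \<le> N\<close> have "R N n = {xs \<in> partitions n. \<forall>p\<in>set xs. Q p}"
        unfolding R_def using order_trans by blast
      then show "fps_nth (\<Prod>i\<le>N. f i) n = fps_nth H n" by (simp add: part G_def H_def)
    qed
  qed
  moreover have "H \<noteq> 0"
  proof -
    have "{xs \<in> partitions 0. \<forall>p\<in>set xs. Q p} = {[]}" by (auto simp: partitions_0)
    then have "fps_nth H 0 = 1" by (simp add: H_def)
    then show ?thesis by auto
  qed
  ultimately have "f has_prod H"
    by (simp add: has_prod_def raw_has_prod_def)
  then show ?thesis by (simp add: f_def H_def)
qed

section \<open>Conjugation exchanges (S) and (C)\<close>

lemma card_ferrers: "card (ferrers xs) = sum_list xs"
proof -
  have "ferrers xs = Sigma {..<length xs} (\<lambda>i. {..<xs ! i})"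
    by (auto simp: ferrers_def)
  then show ?thesis by (simp add: sum_list_sum_nth atLeast0LessThan)
qed

lemma ferrers_inject:
  assumes "is_partition xs" "is_partition ys" "ferrers xs = ferrers ys"
  shows "xs = ys"
proof -
  have len: "i < length zs \<longleftrightarrow> (i, 0) \<in> ferrers zs" if "is_partition zs" for zs i
    using that by (auto simp: ferrers_def is_partition_def)
  have "i < length xs \<longleftrightarrow> i < length ys" for i
    using assms len by simp
  then have "length xs = length ys" by (metis linorder_neqE_nat less_irrefl)
  moreover have "xs ! i = ys ! i" if "i < length xs" for i
  proof -
    have "j < xs ! i \<longleftrightarrow> j < ys ! i" for j
      using assms(3) that calculation by (auto simp: ferrers_def set_eq_iff)
    then show ?thesis by (metis linorder_neqE_nat less_irrefl)
  qed
  ultimately show ?thesis by (rule nth_equalityI)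
qed

lemma bij_betw_conjugate: "bij_betw conjugate (partitions n) (partitions n)"
proof (rule bij_betw_byWitness[where f' = conjugate])
  show inv: "\<forall>xs\<in>partitions n. conjugate (conjugate xs) = xs"
    by (auto simp: partitions_def is_partition_conjugate ferrers_conjugate
        intro: ferrers_inject)
  then show "\<forall>xs\<in>partitions n. conjugate (conjugate xs) = xs" .
  have "sum_list (conjugate xs) = sum_list xs" if "is_partition xs" for xs
    using that by (simp flip: card_ferrers add: ferrers_conjugate)
  then show sub: "conjugate ` partitions n \<subseteq> partitions n"
    by (auto simp: partitions_def is_partition_conjugate)
  then show "conjugate ` partitions n \<subseteq> partitions n" .
qed

text \<open>Both sides are the length of row \<open>i\<close> of the Ferrers diagram; the appended zeros give the
  value \<open>0\<close> to the rows below the diagram.\<close>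

lemma length_filter_conjugate:
  assumes "is_partition xs"
  shows "length (filter (\<lambda>x. i < x) (conjugate xs)) = (xs @ replicate (Suc i) 0) ! i"
proof -
  let ?c = "conjugate xs"
  have "length (filter (\<lambda>x. i < x) ?c) = card {j. (j, i) \<in> ferrers ?c}"
    by (simp add: length_filter_conv_card ferrers_def)
  also have "\<dots> = card {j. (i, j) \<in> ferrers xs}"
    by (simp add: ferrers_conjugate[OF assms])
  also have "{j. (i, j) \<in> ferrers xs} = {..<(xs @ replicate (Suc i) 0) ! i}"
    by (auto simp: ferrers_def nth_append simp del: replicate_Suc)
  finally show ?thesis by simp
qed

text \<open>A last part \<open>2 * j + 1\<close> next to the fictitious zero is excluded for \<open>j = 0\<close> because the
  difference is \<open>1\<close>, and for \<open>j = l\<close> with \<open>1 \<le> l \<le> k\<close> because \<open>0 = 2 * j - 2 * l\<close>.\<close>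

lemma S_adjacency_append_zero:
  assumes "is_partition xs"
  shows "S_adjacency k (xs @ [0]) \<longleftrightarrow> cond_S k xs"
proof (cases "xs = []")
  case True
  then show ?thesis by (simp add: cond_S_def S_adjacency_def S_initial_def adjacent_def)
next
  case False
  have "Min (set xs) = last xs"
  proof (rule Min_eqI)
    fix p assume "p \<in> set xs"
    moreover have "sorted_wrt (\<ge>) (butlast xs @ [last xs])"
      using assms False by (simp add: is_partition_def)
    then have "\<forall>p\<in>set (butlast xs @ [last xs]). last xs \<le> p"
      by (auto simp: sorted_wrt_append simp del: append_butlast_last_id)
    then have "\<forall>p\<in>set xs. last xs \<le> p" using False by simp
    ultimately show "last xs \<le> p" by blast
  qed (use False in auto)
  then have init: "S_initial k xs \<longleftrightarrow> (\<forall>i\<le>k. last xs \<noteq> 2 * i + 1)"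
    using False by (auto simp: S_initial_def)
  have adj: "adjacent (xs @ [0]) a b \<longleftrightarrow> adjacent xs a b \<or> a = last xs \<and> b = 0" for a b
  proof -
    have "(\<exists>i. Suc i < length (xs @ [0]) \<and> a = (xs @ [0]) ! i \<and> b = (xs @ [0]) ! Suc i) \<longleftrightarrow>
      (\<exists>i. (Suc i < length xs \<or> i = length xs - 1) \<and>
         a = (xs @ [0]) ! i \<and> b = (xs @ [0]) ! Suc i)"
      using False by (intro ex_cong1 conj_cong) (cases xs; auto)+
    also have "\<dots> \<longleftrightarrow> adjacent xs a b \<or> a = last xs \<and> b = 0"
      using False by (auto simp: adjacent_def nth_append last_conv_nth conj_disj_distribR ex_disj_distrib)
    finally show ?thesis by (simp add: adjacent_def)
  qed
  have "(int (last xs) - int 0 \<noteq> 1 \<and>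
      (\<forall>j. 2 * j + 1 = last xs \<longrightarrow> (\<forall>l\<in>{1..k}. int 0 \<noteq> 2 * int j - 2 * int l)))
      \<longleftrightarrow> (\<forall>i\<le>k. last xs \<noteq> 2 * i + 1)" (is "?L \<longleftrightarrow> ?R")
  proof
    assume L: ?L
    show ?R
    proof (intro allI impI notI)
      fix i assume "i \<le> k" "last xs = 2 * i + 1"
      with L show False by (cases "i = 0") auto
    qed
  next
    assume R: ?R
    from R have "last xs \<noteq> 2 * 0 + 1" by blast
    then have "int (last xs) - int 0 \<noteq> 1" by simp
    moreover have "int 0 \<noteq> 2 * int j - 2 * int l" if "2 * j + 1 = last xs" "l \<in> {1..k}" for j l
      using R that by auto
    ultimately show ?L by blast
  qed
  moreover have "S_adjacency k (xs @ [0]) \<longleftrightarrow> S_adjacency k xs \<and> int (last xs) - int 0 \<noteq> 1 \<and>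
      (\<forall>j. 2 * j + 1 = last xs \<longrightarrow> (\<forall>l\<in>{1..k}. int 0 \<noteq> 2 * int j - 2 * int l))"
    unfolding S_adjacency_def adj by blast
  ultimately show ?thesis by (simp add: cond_S_def init)
qed

text \<open>With \<open>y i\<close> the \<open>i\<close>-th part of \<open>xs\<close> (zero beyond the end), the part \<open>i + 1\<close> of the
  conjugate has multiplicity \<open>y i - y (i + 1)\<close>, and \<open>y (i + 1)\<close> parts exceed it. Both conditions
  therefore forbid a difference \<open>1\<close>, and a difference \<open>2 * l + 1\<close> with \<open>1 \<le> l \<le> k\<close> above an even
  number.\<close>

lemma cond_S_iff_cond_C:
  assumes "is_partition xs"
  shows "cond_S k xs \<longleftrightarrow> cond_C k (conjugate xs)"
proof -
  define c where "c = conjugate xs"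
  define y where "y i = (xs @ replicate (Suc i) 0) ! i" for i
  have pos: "0 < p" if "p \<in> set c" for p
    using that is_partition_conjugate[OF assms] by (auto simp: c_def is_partition_def)
  have gt: "length (filter (\<lambda>x. i < x) c) = y i" for i
    using length_filter_conjugate[OF assms] by (simp add: c_def y_def)
  have cnt: "y i = y (Suc i) + count_list c (Suc i)" for i
  proof -
    have "length (filter (\<lambda>x. i < x) ys) =
      length (filter (\<lambda>x. Suc i < x) ys) + count_list ys (Suc i)" for ys
      by (induction ys) auto
    then show ?thesis by (metis gt)
  qed
  have y0: "y i = 0" if "length xs \<le> i" for i
    using that by (simp add: y_def nth_append del: replicate_Suc)
  have y1: "(xs @ [0]) ! i = y i" if "i < Suc (length xs)" for i
    using that by (auto simp: y_def nth_append simp del: replicate_Suc)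
  \<comment> \<open>the forbidden configurations at \<open>i\<close>, with the difference expressed as a multiplicity\<close>
  define B where "B i \<longleftrightarrow> count_list c (Suc i) = 1 \<or>
     (\<exists>l\<in>{1..k}. count_list c (Suc i) = 2 * l + 1) \<and> even (y (Suc i))" for i
  have "cond_C k c \<longleftrightarrow> (\<forall>i. Suc i \<in> set c \<longrightarrow> \<not> B i)"
  proof -
    have "cond_C k c \<longleftrightarrow> (\<forall>p\<in>set c. count_list c p \<noteq> 1 \<and>
      ((\<exists>l\<in>{1..k}. count_list c p = 2 * l + 1) \<longrightarrow> odd (y p)))"
      by (auto simp: cond_C_def gt)
    also have "\<dots> \<longleftrightarrow> (\<forall>i. Suc i \<in> set c \<longrightarrow> count_list c (Suc i) \<noteq> 1 \<and>
      ((\<exists>l\<in>{1..k}. count_list c (Suc i) = 2 * l + 1) \<longrightarrow> odd (y (Suc i))))"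
      using pos by (metis gr0_implies_Suc)
    finally show ?thesis by (auto simp: B_def)
  qed
  also have "\<dots> \<longleftrightarrow> (\<forall>i. \<not> B i)"
  proof -
    have "Suc i \<in> set c" if "B i" for i
    proof (rule ccontr)
      assume "Suc i \<notin> set c"
      then have "count_list c (Suc i) = 0" by (simp add: count_list_0_iff)
      with that show False by (auto simp: B_def)
    qed
    then show ?thesis by blast
  qed
  also have "\<dots> \<longleftrightarrow> (\<forall>i<length xs. \<not> B i)"
  proof -
    have "i < length xs" if "B i" for i
    proof (rule ccontr)
      assume "\<not> i < length xs"
      with cnt[of i] y0[of i] have "count_list c (Suc i) = 0" by simp
      with that show False by (auto simp: B_def)
    qed
    then show ?thesis by blast
  qed
  also have "\<dots> \<longleftrightarrow> S_adjacency k (xs @ [0])"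
  proof -
    have "\<not> B i \<longleftrightarrow> int (y i) - int (y (Suc i)) \<noteq> 1 \<and>
      (\<forall>j. y i = 2 * j + 1 \<longrightarrow> (\<forall>l\<in>{1..k}. int (y (Suc i)) \<noteq> 2 * int j - 2 * int l))" for i
    proof -
      have "(\<exists>l\<in>{1..k}. count_list c (Suc i) = 2 * l + 1) \<and> even (y (Suc i)) \<longleftrightarrow>
        (\<exists>j. y i = 2 * j + 1 \<and> (\<exists>l\<in>{1..k}. int (y (Suc i)) = 2 * int j - 2 * int l))"
        (is "?L \<longleftrightarrow> ?R")
      proof
        assume ?L
        then obtain l m where l: "l \<in> {1..k}" "count_list c (Suc i) = 2 * l + 1"
          "y (Suc i) = 2 * m" by auto
        with cnt[of i] have "y i = 2 * (l + m) + 1"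
          "int (y (Suc i)) = 2 * int (l + m) - 2 * int l" by auto
        with l(1) show ?R by blast
      next
        assume ?R
        then obtain j l where j: "y i = 2 * j + 1" "l \<in> {1..k}"
          "int (y (Suc i)) = 2 * int j - 2 * int l" by auto
        have "count_list c (Suc i) = 2 * l + 1" "even (y (Suc i))"
          using j cnt[of i] by presburger+
        with j(2) show ?L by blast
      qed
      then show ?thesis using cnt[of i] unfolding B_def by auto
    qed
    moreover have "adjacent (xs @ [0]) a b \<longleftrightarrow> (\<exists>i<length xs. a = y i \<and> b = y (Suc i))" for a b
      unfolding adjacent_def using y1 by auto
    moreover have "S_adjacency k zs \<longleftrightarrow> (\<forall>a b. adjacent zs a b \<longrightarrow> int a - int b \<noteq> 1 \<and>
      (\<forall>j. a = 2 * j + 1 \<longrightarrow> (\<forall>l\<in>{1..k}. int b \<noteq> 2 * int j - 2 * int l)))" for zs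
      unfolding S_adjacency_def by blast
    ultimately show ?thesis by (metis (no_types, lifting))
  qed
  finally show ?thesis by (simp add: c_def S_adjacency_append_zero[OF assms])
qed

section \<open>Strict partitions and Frobenius symbols\<close>

definition strict_partition :: "nat list \<Rightarrow> bool" where
  "strict_partition xs \<longleftrightarrow> sorted_wrt (>) xs \<and> (\<forall>p\<in>set xs. 0 < p)"

fun alt_sum :: "nat list \<Rightarrow> nat" where
  "alt_sum [] = 0"
| "alt_sum (x # xs) = x - alt_sum xs"

fun alt_weight :: "nat \<Rightarrow> nat \<Rightarrow> nat list \<Rightarrow> nat" where
  "alt_weight a b [] = 0"
| "alt_weight a b (x # xs) = a * x + alt_weight b a xs"

text \<open>The outermost hook of the Ferrers diagram of \<open>frob (x # xs)\<close> has first column of length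
  \<open>alt_sum (x # xs)\<close> and first row of length \<open>alt_sum xs + 1\<close>; inside it lies the diagram for the
  list without its first two entries. For a list of odd length the last hook uses
  \<open>alt_sum [] = 0\<close>, so its row has length \<open>1\<close>.\<close>

function frob :: "nat list \<Rightarrow> nat list" where
  "frob [] = []"
| "frob (x # xs) = Suc (alt_sum xs) # map Suc (frob (tl xs)) @
     replicate (alt_sum (x # xs) - 1 - alt_sum (tl xs)) 1"
  by pat_completeness auto
termination by (relation "Wellfounded.measure length") auto

lemma strict_partition_Cons:
  "strict_partition (x # xs) \<longleftrightarrow> strict_partition xs \<and> 0 < x \<and> (\<forall>y\<in>set xs. y < x)"
  by (auto simp: strict_partition_def)

lemma strict_partition_tl: "strict_partition xs \<Longrightarrow> strict_partition (tl xs)"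
  by (cases xs) (auto simp: strict_partition_Cons)

lemma alt_sum_le_hd: "alt_sum (x # xs) \<le> x"
  by simp

lemma alt_sum_less: "strict_partition (x # xs) \<Longrightarrow> alt_sum xs < x"
  using alt_sum_le_hd[of "hd xs" "tl xs"]
  by (cases xs) (auto simp: strict_partition_Cons simp del: alt_sum.simps(2))

text \<open>This inequality makes the inner diagram fit into its hook: it controls the column lengths,
  and applied to the tail it controls the row lengths.\<close>

lemma alt_sum_tl_tl:
  "strict_partition xs \<Longrightarrow> xs \<noteq> [] \<Longrightarrow> alt_sum (tl (tl xs)) < alt_sum xs"
proof (cases xs rule: alt_sum.cases)
  case (2 x ys)
  assume "strict_partition xs"
  with 2 show ?thesis using alt_sum_less[of x ys] alt_sum_less[of "hd ys" "tl ys"]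
    by (cases ys) (auto simp: strict_partition_Cons)
qed simp

lemma length_frob: "strict_partition xs \<Longrightarrow> length (frob xs) = alt_sum xs"
proof (induction xs rule: frob.induct)
  case (2 x xs)
  have "alt_sum (tl xs) < alt_sum (x # xs)"
    using alt_sum_tl_tl[OF "2.prems"] by simp
  moreover have "length (frob (tl xs)) = alt_sum (tl xs)"
    using 2 by (simp add: strict_partition_Cons strict_partition_tl)
  ultimately show ?case by simp
qed simp

lemma is_partition_frob: "strict_partition xs \<Longrightarrow> is_partition (frob xs)"
proof (induction xs rule: frob.induct)
  case (2 x xs)
  then have s: "strict_partition xs" and IH: "is_partition (frob (tl xs))"
    by (simp_all add: strict_partition_Cons strict_partition_tl)
  have "\<forall>p\<in>set (frob (tl xs)). p \<le> alt_sum xs"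
  proof (cases "tl xs")
    case (Cons y ys)
    have "\<forall>p\<in>set (frob (tl xs)). p \<le> Suc (alt_sum ys)"
      using IH by (simp add: Cons is_partition_def)
    moreover have "alt_sum ys < alt_sum xs"
      using alt_sum_tl_tl[OF s] Cons by (cases xs) auto
    ultimately show ?thesis by auto
  qed simp
  moreover have "sorted_wrt (\<ge>) (replicate m (1 :: nat))" for m
    by (induction m) auto
  ultimately show ?case using IH
    by (auto simp: is_partition_def sorted_wrt_append sorted_wrt_map)
qed (simp add: is_partition_def)

text \<open>Equivalently, \<open>frob\<close> turns the sum of the entries at odd positions into the size, and the
  difference of this and the sum at even positions into the number of parts. The single equation with
  free weights follows by removing one hook, that is two entries, at a time: the entries are
  \<open>s0 + s1\<close> and \<open>s1 + s2\<close>, and the hook has \<open>s0 + s1\<close> cells.\<close>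

lemma alt_weight_frob:
  "strict_partition xs \<Longrightarrow>
    alt_weight a b xs + b * length (frob xs) = (a + b) * sum_list (frob xs)"
proof (induction xs rule: frob.induct)
  case (2 x xs)
  then have s: "strict_partition xs" by (simp add: strict_partition_Cons)
  have lt: "alt_sum xs < x" "alt_sum (tl xs) < alt_sum (x # xs)"
    using alt_sum_less[OF "2.prems"] alt_sum_tl_tl[OF "2.prems"] by simp_all
  define s0 where "s0 = alt_sum (x # xs)"
  define s1 where "s1 = alt_sum xs"
  define s2 where "s2 = alt_sum (tl xs)"
  define r where "r = sum_list (frob (tl xs))"
  have x: "x = s0 + s1" and s02: "s2 < s0"
    using lt by (simp_all add: s0_def s1_def s2_def)
  have len: "length (frob (tl xs)) = s2"
    using s by (simp add: s2_def length_frob strict_partition_tl)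
  have "sum_list (frob (x # xs)) = Suc s1 + (r + s2) + (s0 - 1 - s2)"
    unfolding frob.simps s0_def[symmetric] s1_def[symmetric] s2_def[symmetric]
    by (simp add: r_def sum_list_replicate sum_list_Suc len)
  then have sum: "sum_list (frob (x # xs)) = s0 + s1 + r" using s02 by simp
  have w: "alt_weight a b (tl xs) + b * s2 = (a + b) * r"
    using 2 s by (simp add: strict_partition_tl len r_def)
  have tl: "alt_weight b a xs = b * (if xs = [] then 0 else hd xs) + alt_weight a b (tl xs)"
    by (cases xs) auto
  have hd: "(if xs = [] then 0 else hd xs) = s1 + s2"
    using s alt_sum_less[of "hd xs" "tl xs"] by (cases xs) (auto simp: s1_def s2_def)
  have L: "length (frob (x # xs)) = s0"
    using length_frob[OF "2.prems"] by (simp only: s0_def)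
  have W: "alt_weight a b (x # xs) = a * (s0 + s1) + (b * (s1 + s2) + alt_weight a b (tl xs))"
    by (simp only: alt_weight.simps tl hd x)
  show ?case
    unfolding L W sum using w by (simp add: algebra_simps)
qed simp

text \<open>Recovers the inner diagram from the rows below the first one.\<close>

lemma filter_frob: 
  "map (\<lambda>x. x - 1) (filter (\<lambda>x. 1 < x) (map Suc xs @ replicate m 1)) = filter (\<lambda>x. 0 < x) xs"
  by (induction xs) auto

text \<open>The length and the head give the first two alternating sums, the inner diagram gives the
  list from the third entry on by induction, and consecutive alternating sums add up to the entries.\<close>

lemma inj_on_frob: "inj_on frob {xs. strict_partition xs}"
proof -
  have "xs = ys" if "strict_partition xs" "strict_partition ys" "frob xs = frob ys" for xs ys
    using that
  proof (induction xs arbitrary: ys rule: frob.induct)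
    case 1
    then show ?case by (cases ys) auto
  next
    case (2 x xs)
    from 2 obtain y zs where ys: "ys = y # zs" by (cases ys) auto
    have s: "strict_partition xs" "strict_partition zs"
      using 2 ys by (simp_all add: strict_partition_Cons)
    have s1: "alt_sum xs = alt_sum zs" using 2 ys by simp
    have s0: "alt_sum (x # xs) = alt_sum (y # zs)" using 2 ys length_frob by metis
    have fil: "filter (\<lambda>x. 0 < x) (frob us) = frob us" if "strict_partition us" for us
      using is_partition_frob[OF that] by (auto simp: is_partition_def)
    have t: "map (\<lambda>x. x - 1) (filter (\<lambda>x. 1 < x) (tl (frob (u # us)))) = frob (tl us)"
      if "strict_partition us" for u us
      unfolding frob.simps list.sel filter_frob
      using that by (simp add: fil strict_partition_tl)
    have "frob (tl xs) = frob (tl zs)"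
      using t[OF s(1), of x] t[OF s(2), of y] 2(4) ys by metis
    then have tl: "tl xs = tl zs"
      using 2(1) s by (simp add: strict_partition_tl)
    have xy: "x = y"
      using s0 s1 alt_sum_less[of x xs] alt_sum_less[of y zs] 2 ys by auto
    have "xs = zs"
    proof (cases "xs = [] \<or> zs = []")
      case True
      then show ?thesis
        using s s1 by (metis alt_sum.simps(1) alt_sum_tl_tl not_less_zero)
    next
      case False
      then have "hd xs = hd zs"
        using tl s s1 alt_sum_less[of "hd xs" "tl xs"] alt_sum_less[of "hd zs" "tl zs"]
        by (cases xs; cases zs) auto
      with False tl show ?thesis by (simp add: list.expand)
    qed
    with xy ys show ?case by simp
  qed
  then show ?thesis by (auto intro: inj_onI)
qed

lemma partition_split_ones:
  assumes "is_partition zs"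
  shows "\<exists>us m. is_partition us \<and> zs = map Suc us @ replicate m 1"
  using assms
proof (induction zs)
  case Nil
  then show ?case by (auto simp: is_partition_def)
next
  case (Cons z zs)
  show ?case
  proof (cases "z = 1")
    case True
    have "zs = replicate (length zs) 1"
      using Cons.prems True by (intro replicate_eqI) (auto simp: is_partition_def le_antisym Suc_leI)
    then have "z # zs = map Suc [] @ replicate (Suc (length zs)) 1" using True by simp
    moreover have "is_partition []" by (simp add: is_partition_def)
    ultimately show ?thesis by blast
  next
    case False
    have "is_partition zs" using Cons.prems by (simp add: is_partition_def)
    then obtain us m where us: "is_partition us" "zs = map Suc us @ replicate m 1"
      using Cons.IH by blast
    have "\<forall>y\<in>set zs. y \<le> z" "0 < z" using Cons.prems by (simp_all add: is_partition_def)
    then have "\<forall>y\<in>set us. Suc y \<le> z" unfolding us(2) by simp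
    then have "\<forall>y\<in>set us. y \<le> z - 1" by auto
    then have "is_partition ((z - 1) # us)"
      using us(1) False \<open>0 < z\<close> by (simp add: is_partition_def)
    moreover have "z # zs = map Suc ((z - 1) # us) @ replicate m 1"
      using us(2) \<open>0 < z\<close> by simp
    ultimately show ?thesis by blast
  qed
qed

text \<open>Removing the outermost hook leaves a smaller partition \<open>us = frob rs\<close>. The leg and arm of
  the hook prescribe the alternating sums \<open>s0\<close> and \<open>s1\<close> of the two new leading entries, which are
  \<open>s0 + s1\<close> and \<open>s1 + alt_sum rs\<close>.\<close>

lemma frob_surj:
  "is_partition zs \<Longrightarrow> \<exists>xs. strict_partition xs \<and> frob xs = zs"
proof (induction zs rule: length_induct)
  case (1 zs)
  show ?case
  proof (cases zs)
    case Nil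
    then show ?thesis by (intro exI[of _ "[]"]) (simp add: strict_partition_def)
  next
    case (Cons z ws)
    with 1 have ws: "is_partition ws" by (simp add: is_partition_def)
    then obtain us m where us: "is_partition us" "ws = map Suc us @ replicate m 1"
      using partition_split_ones by blast
    have "length us < length zs" using us Cons by simp
    then obtain rs where rs: "strict_partition rs" "frob rs = us"
      using 1 us by blast
    have len: "alt_sum rs = length us" using rs length_frob by metis
    have z: "0 < z" using "1.prems" Cons by (simp add: is_partition_def)
    define s1 where "s1 = z - 1"
    define s0 where "s0 = Suc (length ws)"
    have rs1: "alt_sum (tl rs) < s1" if "rs \<noteq> []"
    proof -
      have "hd us = Suc (alt_sum (tl rs))" "us \<noteq> []"
        using that rs by (cases rs; auto)+
      moreover then have "Suc (hd us) \<le> z"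
        using "1.prems" us(2) Cons by (cases us) (auto simp: is_partition_def)
      ultimately show ?thesis by (simp add: s1_def)
    qed
    \<comment> \<open>If \<open>s1 = 0\<close>, the hook is a single column, \<open>rs\<close> is empty, and the list has one entry.\<close>
    define xs where "xs = (if s1 = 0 then [] else (s1 + alt_sum rs) # rs)"
    have tl: "tl xs = rs" using rs1 by (auto simp: xs_def)
    have alt: "alt_sum xs = s1" by (simp add: xs_def)
    have hd_rs: "hd rs = alt_sum rs + alt_sum (tl rs)" if "rs \<noteq> []"
      using that rs(1) alt_sum_less[of "hd rs" "tl rs"] by (cases rs) auto
    have dom: "y \<le> hd rs" if "y \<in> set rs" for y
      using that rs(1) by (cases rs) (auto simp: strict_partition_Cons)
    have xs: "strict_partition xs"
    proof (cases "rs = []")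
      case True
      then show ?thesis by (simp add: xs_def strict_partition_def)
    next
      case False
      have "y < s1 + alt_sum rs" if "y \<in> set rs" for y
        using dom[OF that] rs1[OF False] hd_rs[OF False] by simp
      then show ?thesis using rs1[OF False] rs(1) by (simp add: xs_def strict_partition_Cons)
    qed
    have len2: "length us < s0" using us by (simp add: s0_def)
    have "strict_partition ((s0 + s1) # xs)"
    proof -
      have "y < s0 + s1" if "y \<in> set xs" for y
        using that xs len len2 by (auto simp: xs_def strict_partition_Cons split: if_splits)
      with xs show ?thesis by (simp add: strict_partition_Cons s0_def)
    qed
    moreover have "frob ((s0 + s1) # xs) = zs"
      using us rs z by (simp add: tl alt len Cons s1_def) (simp add: s0_def)
    ultimately show ?thesis by blast
  qed
qed

lemma bij_betw_frob: "bij_betw frob {xs. strict_partition xs} {zs. is_partition zs}"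
proof (rule bij_betw_imageI[OF inj_on_frob])
  show "frob ` {xs. strict_partition xs} = {zs. is_partition zs}"
  proof (intro equalityI subsetI)
    fix zs assume "zs \<in> {zs. is_partition zs}"
    then obtain xs where "strict_partition xs" "frob xs = zs" using frob_surj by auto
    then show "zs \<in> frob ` {xs. strict_partition xs}" by (intro image_eqI[of _ _ xs]) simp_all
  qed (auto intro: is_partition_frob)
qed

section \<open>Parts of odd multiplicity in (C)\<close>

lemma strict_partition_imp_is_partition: "strict_partition xs \<Longrightarrow> is_partition xs"
  unfolding strict_partition_def is_partition_def
  by (auto intro: sorted_wrt_mono_rel[of _ "(>)"])

lemma distinct_strict_partition: "strict_partition xs \<Longrightarrow> distinct xs"
  by (induction xs) (auto simp: strict_partition_Cons)

lemma bij_betw_mset: "bij_betw mset {xs. is_partition xs} {X. 0 \<notin># X}"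
proof -
  have sorted: "sorted (rev xs) \<longleftrightarrow> sorted_wrt (\<ge>) xs" for xs :: "nat list"
    by (simp add: sorted_wrt_rev)
  have "rev (sorted_list_of_multiset X) \<in> {xs. is_partition xs}" if "0 \<notin># X" for X
    using that by (auto simp: is_partition_def simp flip: sorted intro: gr0I)
  moreover have "rev (sorted_list_of_multiset (mset xs)) = xs" if "is_partition xs" for xs
    using that sorted[of xs]
    by (simp add: is_partition_def sorted_list_of_multiset_mset) (metis mset_rev properties_for_sort rev_rev_ident)
  ultimately show ?thesis
    by (intro bij_betw_byWitness[where f' = "\<lambda>X. rev (sorted_list_of_multiset X)"])
      (auto simp: is_partition_def)
qed

lemma strict_partition_set_inject:
  assumes "strict_partition xs" "strict_partition ys" "set xs = set ys"
  shows "xs = ys"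
proof -
  have "mset xs = mset ys"
    using assms distinct_strict_partition by (simp flip: set_eq_iff_mset_eq_distinct)
  then show ?thesis
    using assms bij_betw_mset strict_partition_imp_is_partition
    by (auto simp: bij_betw_def inj_on_def)
qed

lemma even_counts_double:
  assumes "\<And>p. even (count X p)"
  shows "\<exists>M. X = M + M"
proof -
  define M where "M = Abs_multiset (\<lambda>p. count X p div 2)"
  have "finite {p. 0 < count X p div 2}"
    by (rule finite_subset[of _ "set_mset X"]) (auto intro: ccontr simp: not_in_iff)
  then have "count M p = count X p div 2" for p
    by (simp add: M_def)
  moreover have "count X p = count X p div 2 + count X p div 2" for p
    using assms[of p] by presburger
  ultimately have "X = M + M"
    by (intro multiset_eqI) (simp only: count_union)
  then show ?thesis ..
qed

lemma double_mset_inject: "M + M = N + N \<longleftrightarrow> M = (N :: 'a multiset)"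
  by (auto simp: multiset_eq_iff simp flip: mult_2)

fun alt_mset :: "nat \<Rightarrow> nat \<Rightarrow> nat list \<Rightarrow> nat multiset" where
  "alt_mset a b [] = {#}"
| "alt_mset a b (x # xs) = replicate_mset a x + alt_mset b a xs"

lemma sum_alt_mset: "sum_mset (alt_mset a b xs) = alt_weight a b xs"
  by (induction a b xs rule: alt_mset.induct) auto

lemma count_alt_mset_notin: "p \<notin> set xs \<Longrightarrow> count (alt_mset a b xs) p = 0"
  by (induction a b xs rule: alt_mset.induct) auto

lemma count_alt_mset:
  "strict_partition xs \<Longrightarrow> p \<in> set xs \<Longrightarrow>
    count (alt_mset a b xs) p = (if even (length (filter (\<lambda>y. p < y) xs)) then a else b)"
proof (induction a b xs rule: alt_mset.induct)
  case (2 a b x xs)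
  show ?case
  proof (cases "p = x")
    case True
    have "filter (\<lambda>y. x < y) xs = []"
      using 2 by (auto simp: strict_partition_Cons filter_empty_conv)
    moreover have "x \<notin> set xs" using 2 by (auto simp: strict_partition_Cons)
    ultimately show ?thesis using True by (simp add: count_alt_mset_notin)
  next
    case False
    then show ?thesis using 2 by (auto simp: strict_partition_Cons)
  qed
qed simp

text \<open>The assumption says that multiplicities in \<open>X\<close> and \<open>xs\<close> have the same parity; below, \<open>xs\<close>
  lists the elements of odd multiplicity, the only ones that affect the parity of a size.\<close>

lemma even_size_filter_double:
  assumes "X + mset xs = N + N"
  shows "even (size (filter_mset P X)) \<longleftrightarrow> even (length (filter P xs))"
proof -
  have "size (filter_mset P X) + length (filter P xs) = size (filter_mset P (X + mset xs))"
    by (simp flip: mset_filter)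
  also have "\<dots> = 2 * size (filter_mset P N)" by (simp add: assms)
  finally have "even (size (filter_mset P X) + length (filter P xs))" by simp
  then show ?thesis by simp
qed

definition C_mset :: "nat \<Rightarrow> nat multiset \<Rightarrow> bool" where
  "C_mset k X \<longleftrightarrow> (\<forall>p. count X p \<noteq> 1 \<and>
     ((\<exists>l\<in>{1..k}. count X p = 2 * l + 1) \<longrightarrow> odd (size (filter_mset (\<lambda>x. p < x) X))))"

text \<open>Absent parts have multiplicity \<open>0\<close>, which neither clause of (C) mentions.\<close>

lemma cond_C_iff_C_mset: "cond_C k xs \<longleftrightarrow> C_mset k (mset xs)"
proof -
  have *: "size (filter_mset P (mset xs)) = length (filter P xs)" for P
    by (simp flip: mset_filter)
  have "count (mset xs) p = 0" if "p \<notin> set xs" for p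
    using that by (simp add: count_mset_0_iff)
  then show ?thesis
    unfolding cond_C_def C_mset_def * count_mset[symmetric] by fastforce
qed

lemma odd_count_iff:
  assumes "strict_partition xs" "odd a" "odd b"
  shows "odd (count (M + M + alt_mset a b xs) p) \<longleftrightarrow> p \<in> set xs"
  using assms count_alt_mset[of xs p a b] count_alt_mset_notin[of p xs a b]
  by (cases "p \<in> set xs") auto

lemma odd_counts_add_mset:
  assumes "strict_partition xs" "\<And>p. odd (count X p) \<longleftrightarrow> p \<in> set xs"
  shows "\<exists>N. X + mset xs = N + N"
proof (rule even_counts_double)
  fix p
  have "count (mset xs) p = (if p \<in> set xs then 1 else 0)"
    using distinct_strict_partition[OF assms(1)] by (simp add: distinct_count_atmost_1)
  then show "even (count (X + mset xs) p)" using assms(2)[of p] by auto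
qed

lemma C_mset_alt_mset:
  assumes "strict_partition xs"
  shows "C_mset k (M + M + alt_mset (2 * k + 3) 3 xs)" (is "C_mset k ?X")
  unfolding C_mset_def
proof
  fix p
  have odd: "odd (count ?X q) \<longleftrightarrow> q \<in> set xs" for q
    using assms by (intro odd_count_iff) auto
  obtain N where N: "?X + mset xs = N + N"
    using odd_counts_add_mset[OF assms odd] by blast
  show "count ?X p \<noteq> 1 \<and> ((\<exists>l\<in>{1..k}. count ?X p = 2 * l + 1) \<longrightarrow>
    odd (size (filter_mset (\<lambda>x. p < x) ?X)))"
  proof (cases "p \<in> set xs")
    case False
    then have "even (count ?X p)" using odd by blast
    then obtain c where c: "count ?X p = 2 * c" by (elim evenE)
    have "2 * c \<noteq> 2 * l + 1" for l by presburger
    with c show ?thesis by simp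
  next
    case True
    then show ?thesis
      using count_alt_mset[OF assms True, of "2 * k + 3" 3]
      unfolding even_size_filter_double[OF N] by auto
  qed
qed

text \<open>The strict partition consists of the parts of odd multiplicity. The number of its entries
  above a given entry has the same parity as the number of all parts above it, so (C) bounds the
  multiplicities of its entries from below by exactly the multiplicities in \<open>alt_mset\<close>.\<close>

lemma C_mset_decompose:
  assumes "C_mset k X" "0 \<notin># X"
  shows "\<exists>M xs. strict_partition xs \<and> X = M + M + alt_mset (2 * k + 3) 3 xs"
proof -
  define A where "A = {p. odd (count X p)}"
  have A: "A \<subseteq> set_mset X" by (auto simp: A_def not_in_iff intro: ccontr)
  then have fin: "finite A" by (rule finite_subset) simp
  define xs where "xs = rev (sorted_list_of_set A)"
  have "\<forall>p\<in>A. 0 < p" using A assms(2) by (metis gr0I subsetD)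
  then have strict: "strict_partition xs"
    using fin by (simp add: xs_def strict_partition_def sorted_wrt_rev)
  have odd: "odd (count X p) \<longleftrightarrow> p \<in> set xs" for p
    using fin by (simp add: xs_def A_def)
  obtain N where N: "X + mset xs = N + N"
    using odd_counts_add_mset[OF strict odd] by blast
  let ?Y = "alt_mset (2 * k + 3) 3 xs"
  have le: "count ?Y p \<le> count X p" for p
  proof (cases "p \<in> set xs")
    case True
    then have "odd (count X p)" using odd by simp
    then obtain l where l: "count X p = 2 * l + 1" by (elim oddE)
    have "count X p \<noteq> 1" using assms(1) unfolding C_mset_def by blast
    with l have "l \<noteq> 0" by auto
    moreover have "odd (length (filter (\<lambda>x. p < x) xs))" if "l \<le> k"
    proof -
      have "l \<in> {1..k}" using \<open>l \<noteq> 0\<close> that by simp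
      then have "odd (size (filter_mset (\<lambda>x. p < x) X))"
        using assms(1) l unfolding C_mset_def by blast
      then show ?thesis using even_size_filter_double[OF N] by simp
    qed
    ultimately show ?thesis
      using count_alt_mset[OF strict True, of "2 * k + 3" 3] l by (cases "l \<le> k") auto
  qed (simp add: count_alt_mset_notin)
  have "even (count (X - ?Y) p)" for p
    using odd[of p] odd_count_iff[OF strict, of "2 * k + 3" 3 "{#}" p] le[of p] by auto
  then obtain M where "X - ?Y = M + M" using even_counts_double by blast
  moreover have "?Y \<subseteq># X" using le by (simp add: subseteq_mset_def)
  ultimately have "X = M + M + ?Y" by (metis subset_mset.diff_add)
  with strict show ?thesis by blast
qed

lemma bij_betw_C_mset:
  "bij_betw (\<lambda>(M, xs). M + M + alt_mset (2 * k + 3) 3 xs)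
    ({M. 0 \<notin># M} \<times> {xs. strict_partition xs}) {X. 0 \<notin># X \<and> C_mset k X}"
  (is "bij_betw ?f ?A ?B")
proof (rule bij_betw_imageI)
  show "inj_on ?f ?A"
  proof (rule inj_onI, clarsimp)
    fix M xs N ys
    assume s: "strict_partition xs" "strict_partition ys"
      and eq: "M + M + alt_mset (2 * k + 3) 3 xs = N + N + alt_mset (2 * k + 3) 3 ys"
    have "p \<in> set xs \<longleftrightarrow> p \<in> set ys" for p
      using odd_count_iff[OF s(1), of "2 * k + 3" 3 M p]
        odd_count_iff[OF s(2), of "2 * k + 3" 3 N p] eq by simp
    then have "xs = ys" using s by (intro strict_partition_set_inject) auto
    with eq show "M = N \<and> xs = ys" by (simp add: double_mset_inject)
  qed
  have zero: "0 \<notin># M + M + alt_mset a b xs \<longleftrightarrow> 0 \<notin># M" if "strict_partition xs" for M a b xs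
    using that count_alt_mset_notin[of 0 xs a b]
    by (auto simp: not_in_iff strict_partition_def)
  show "?f ` ?A = ?B"
  proof (intro equalityI subsetI)
    fix X assume "X \<in> ?f ` ?A"
    then obtain M xs where "0 \<notin># M" "strict_partition xs"
      "X = M + M + alt_mset (2 * k + 3) 3 xs" by auto
    then show "X \<in> ?B" using zero C_mset_alt_mset by blast
  next
    fix X assume "X \<in> ?B"
    moreover from this obtain M xs
      where xs: "strict_partition xs" "X = M + M + alt_mset (2 * k + 3) 3 xs"
      using C_mset_decompose by blast
    ultimately have "0 \<notin># M" using zero by blast
    with xs show "X \<in> ?f ` ?A" by (intro image_eqI[of _ _ "(M, xs)"]) auto
  qed
qed

section \<open>Parts allowed by (P)\<close>

lemma P_part_iff: "P_part k p \<longleftrightarrow> even p \<or> (2 * k + 6) dvd (p + 3)"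
proof -
  have "[int p = - 3] (mod int (2 * k + 6)) \<longleftrightarrow> int (2 * k + 6) dvd int (p + 3)"
    by (simp add: cong_iff_dvd_diff)
  then show ?thesis unfolding P_part_def by (simp only: int_dvd_int_iff)
qed

lemma bij_betw_image_mset_Un:
  assumes f: "bij_betw f A B" and g: "bij_betw g C D" and disj: "B \<inter> D = {}"
  shows "bij_betw (\<lambda>(M, N). image_mset f M + image_mset g N)
    ({M. set_mset M \<subseteq> A} \<times> {N. set_mset N \<subseteq> C}) {X. set_mset X \<subseteq> B \<union> D}"
proof (rule bij_betw_byWitness[where f' = "\<lambda>X.
    (image_mset (inv_into A f) (filter_mset (\<lambda>p. p \<in> B) X),
     image_mset (inv_into C g) (filter_mset (\<lambda>p. p \<in> D) X))"])
  let ?F = "\<lambda>(M, N). image_mset f M + image_mset g N"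
  let ?G = "\<lambda>X. (image_mset (inv_into A f) (filter_mset (\<lambda>p. p \<in> B) X),
     image_mset (inv_into C g) (filter_mset (\<lambda>p. p \<in> D) X))"
  have inv: "\<And>x. x \<in> A \<Longrightarrow> inv_into A f (f x) = x" "\<And>x. x \<in> C \<Longrightarrow> inv_into C g (g x) = x"
    "\<And>y. y \<in> B \<Longrightarrow> f (inv_into A f y) = y" "\<And>y. y \<in> D \<Longrightarrow> g (inv_into C g y) = y"
    "\<And>y. y \<in> B \<Longrightarrow> inv_into A f y \<in> A" "\<And>y. y \<in> D \<Longrightarrow> inv_into C g y \<in> C"
    using f g by (simp_all add: bij_betw_inv_into_left bij_betw_inv_into_right)
      (metis bij_betw_def inv_into_into)+
  have mem: "\<And>x. x \<in> A \<Longrightarrow> f x \<in> B" "\<And>x. x \<in> C \<Longrightarrow> g x \<in> D"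
    using f g by (simp_all add: bij_betwE)
  have not_mem: "\<And>x. x \<in> A \<Longrightarrow> f x \<notin> D" "\<And>x. x \<in> C \<Longrightarrow> g x \<notin> B"
    using mem disj by blast+
  show "\<forall>MN\<in>{M. set_mset M \<subseteq> A} \<times> {N. set_mset N \<subseteq> C}. ?G (?F MN) = MN"
  proof
    fix MN assume "MN \<in> {M. set_mset M \<subseteq> A} \<times> {N. set_mset N \<subseteq> C}"
    then obtain M N where MN: "MN = (M, N)"
      and M: "set_mset M \<subseteq> A" and N: "set_mset N \<subseteq> C" by auto
    have "filter_mset (\<lambda>p. p \<in> B) (image_mset f M) = image_mset f M"
      "filter_mset (\<lambda>p. p \<in> D) (image_mset f M) = {#}"
      "filter_mset (\<lambda>p. p \<in> D) (image_mset g N) = image_mset g N"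
      "filter_mset (\<lambda>p. p \<in> B) (image_mset g N) = {#}"
      unfolding filter_mset_eq_conv filter_mset_eq_mempty_iff using M N mem not_mem by auto
    moreover have "image_mset (\<lambda>x. inv_into A f (f x)) M = image_mset (\<lambda>x. x) M"
      by (rule image_mset_cong) (use M inv in auto)
    moreover have "image_mset (\<lambda>x. inv_into C g (g x)) N = image_mset (\<lambda>x. x) N"
      by (rule image_mset_cong) (use N inv in auto)
    ultimately show "?G (?F MN) = MN"
      by (simp add: MN multiset.map_comp comp_def)
  qed
  show "\<forall>X\<in>{X. set_mset X \<subseteq> B \<union> D}. ?F (?G X) = X"
  proof
    fix X assume "X \<in> {X. set_mset X \<subseteq> B \<union> D}"
    then have X: "set_mset X \<subseteq> B \<union> D" by simp
    have "image_mset (\<lambda>y. f (inv_into A f y)) (filter_mset (\<lambda>p. p \<in> B) X) =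
        image_mset (\<lambda>y. y) (filter_mset (\<lambda>p. p \<in> B) X)"
      by (rule image_mset_cong) (use inv in auto)
    moreover have "image_mset (\<lambda>y. g (inv_into C g y)) (filter_mset (\<lambda>p. p \<in> D) X) =
        image_mset (\<lambda>y. y) (filter_mset (\<lambda>p. p \<in> D) X)"
      by (rule image_mset_cong) (use inv in auto)
    moreover have "filter_mset (\<lambda>p. p \<in> D) X = filter_mset (\<lambda>p. p \<notin> B) X"
      by (rule filter_mset_cong) (use X disj in auto)
    moreover have "filter_mset (\<lambda>p. p \<in> B) X + filter_mset (\<lambda>p. p \<notin> B) X = X"
      by (rule multiset_partition[symmetric])
    ultimately show "?F (?G X) = X" by (simp add: multiset.map_comp comp_def)
  qed
  show "?F ` ({M. set_mset M \<subseteq> A} \<times> {N. set_mset N \<subseteq> C}) \<subseteq> {X. set_mset X \<subseteq> B \<union> D}"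
    using mem by (auto simp: subset_iff)
  show "?G ` {X. set_mset X \<subseteq> B \<union> D} \<subseteq> {M. set_mset M \<subseteq> A} \<times> {N. set_mset N \<subseteq> C}"
    using inv by (auto simp: subset_iff)
qed

lemma bij_betw_odd_P_part:
  "bij_betw (\<lambda>m. (2 * k + 6) * m - 3) {m. m \<noteq> 0} {p. odd p \<and> P_part k p}"
proof (rule bij_betw_byWitness[where f' = "\<lambda>p. (p + 3) div (2 * k + 6)"])
  have add3: "(2 * k + 6) * m - 3 + 3 = (2 * k + 6) * m" if "m \<noteq> 0" for m
    using that by (cases m) simp_all
  then show "\<forall>m\<in>{m. m \<noteq> 0}. ((2 * k + 6) * m - 3 + 3) div (2 * k + 6) = m"
    by simp
  show "(\<lambda>m. (2 * k + 6) * m - 3) ` {m. m \<noteq> 0} \<subseteq> {p. odd p \<and> P_part k p}"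
  proof (rule image_subsetI)
    fix m :: nat assume "m \<in> {m. m \<noteq> 0}"
    then have m: "m \<noteq> 0" by simp
    have "even ((2 * k + 6) * m - 3 + 3)" unfolding add3[OF m] by simp
    then have "odd ((2 * k + 6) * m - 3)" by (simp only: even_add) simp
    moreover have "P_part k ((2 * k + 6) * m - 3)"
      unfolding P_part_iff add3[OF m] by simp
    ultimately show "(2 * k + 6) * m - 3 \<in> {p. odd p \<and> P_part k p}" by blast
  qed
  have mult: "(2 * k + 6) * ((p + 3) div (2 * k + 6)) = p + 3" if "odd p" "P_part k p" for p
    using that unfolding P_part_iff by (metis dvd_mult_div_cancel)
  then show "\<forall>p\<in>{p. odd p \<and> P_part k p}. (2 * k + 6) * ((p + 3) div (2 * k + 6)) - 3 = p"
    by simp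
  show "(\<lambda>p. (p + 3) div (2 * k + 6)) ` {p. odd p \<and> P_part k p} \<subseteq> {m. m \<noteq> 0}"
  proof (rule image_subsetI)
    fix p assume "p \<in> {p. odd p \<and> P_part k p}"
    then have "(2 * k + 6) * ((p + 3) div (2 * k + 6)) = p + 3" using mult by blast
    then have "(p + 3) div (2 * k + 6) \<noteq> 0"
      by (metis add_eq_0_iff_both_eq_0 mult_0_right zero_neq_numeral)
    then show "(p + 3) div (2 * k + 6) \<in> {m. m \<noteq> 0}" by blast
  qed
qed

lemma bij_betw_P_mset:
  "bij_betw (\<lambda>(M, N). image_mset (\<lambda>m. 2 * m) M + image_mset (\<lambda>m. (2 * k + 6) * m - 3) N)
    ({M. 0 \<notin># M} \<times> {N. 0 \<notin># N}) {X. 0 \<notin># X \<and> (\<forall>p\<in>#X. P_part k p)}"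
proof -
  have "bij_betw (\<lambda>m :: nat. 2 * m) {m. m \<noteq> 0} {p. p \<noteq> 0 \<and> even p}"
    by (auto simp: bij_betw_def inj_on_def elim!: evenE)
  from bij_betw_image_mset_Un[OF this bij_betw_odd_P_part[of k]]
  have "bij_betw (\<lambda>(M, N). image_mset (\<lambda>m. 2 * m) M + image_mset (\<lambda>m. (2 * k + 6) * m - 3) N)
    ({M. set_mset M \<subseteq> {m. m \<noteq> 0}} \<times> {N. set_mset N \<subseteq> {m. m \<noteq> 0}})
    {X. set_mset X \<subseteq> {p. p \<noteq> 0 \<and> even p} \<union> {p. odd p \<and> P_part k p}}"
    by auto
  moreover have "set_mset M \<subseteq> {m. m \<noteq> 0} \<longleftrightarrow> 0 \<notin># M" for M :: "nat multiset"
    unfolding subset_iff mem_Collect_eq by metis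
  moreover have "{p. p \<noteq> 0 \<and> even p} \<union> {p. odd p \<and> P_part k p} = {p. p \<noteq> 0 \<and> P_part k p}"
    by (auto simp: P_part_def intro: odd_pos)
  moreover have "set_mset X \<subseteq> {p. p \<noteq> 0 \<and> P_part k p} \<longleftrightarrow> 0 \<notin># X \<and> (\<forall>p\<in>#X. P_part k p)" for X
    unfolding subset_iff mem_Collect_eq by metis
  ultimately show ?thesis by (simp only:)
qed

section \<open>The partition identity\<close>

lemma card_fibre_bij_betw:
  assumes "bij_betw f A B" "\<And>x. x \<in> A \<Longrightarrow> w (f x) = v x"
  shows "card {y \<in> B. w y = n} = card {x \<in> A. v x = n}"
proof -
  have "bij_betw f {x \<in> A. v x = n} {y \<in> B. w y = n}"
    using assms by (auto simp: bij_betw_def inj_on_def)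
  then show ?thesis by (simp add: bij_betw_same_card)
qed

lemma card_partitions_mset:
  "card {xs \<in> partitions n. Q (mset xs)} = card {X. (0 \<notin># X \<and> Q X) \<and> sum_mset X = n}"
proof -
  have "bij_betw mset {xs. is_partition xs \<and> Q (mset xs)} {X. 0 \<notin># X \<and> Q X}"
    using bij_betw_mset by (auto simp: bij_betw_def inj_on_def) 
  from card_fibre_bij_betw[OF this, of sum_mset sum_list n] show ?thesis
    by (simp add: partitions_def sum_mset_sum_list conj_ac)
qed

lemma sum_odd_parts:
  assumes "is_partition zs" "0 < a"
  shows "sum_mset (image_mset (\<lambda>m. (a + b) * m - b) (mset zs)) + b * length zs = (a + b) * sum_list zs"
  using assms(1)
proof (induction zs)
  case (Cons z zs)
  then have "b \<le> (a + b) * z" by (cases z) (auto simp: is_partition_def)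
  with Cons show ?case by (simp add: is_partition_def algebra_simps)
qed simp

text \<open>Both sides count the pairs of a multiset of positive numbers and a strict partition by the
  same weight; for (P) the strict partition is first transformed by \<open>frob\<close>.\<close>

lemma card_cond_P_eq_cond_C:
  "card {xs \<in> partitions n. cond_P k xs} = card {xs \<in> partitions n. cond_C k xs}"
proof -
  let ?D = "{M. 0 \<notin># M} \<times> {xs. strict_partition xs}"
  let ?v = "\<lambda>(M, xs). 2 * sum_mset M + alt_weight (2 * k + 3) 3 xs"
  let ?h = "\<lambda>(M, N). image_mset (\<lambda>m. 2 * m) M + image_mset (\<lambda>m. (2 * k + 6) * m - 3) N"
  have "bij_betw (map_prod id (mset \<circ> frob)) ?D ({M. 0 \<notin># M} \<times> {N. 0 \<notin># N})"
    by (intro bij_betw_map_prod bij_betw_id bij_betw_trans[OF bij_betw_frob bij_betw_mset])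
  from bij_betw_trans[OF this bij_betw_P_mset[of k]]
  have bij: "bij_betw (?h \<circ> map_prod id (mset \<circ> frob)) ?D {X. 0 \<notin># X \<and> (\<forall>p\<in>#X. P_part k p)}" .
  have weight: "sum_mset ((?h \<circ> map_prod id (mset \<circ> frob)) x) = ?v x" if x_in: "x \<in> ?D" for x
  proof -
    obtain M xs where x: "x = (M, xs)" "strict_partition xs" using x_in by auto
    have *: "2 * k + 3 + 3 = 2 * k + 6" by simp
    have "sum_mset (image_mset (\<lambda>m. (2 * k + 6) * m - 3) (mset (frob xs))) + 3 * length (frob xs) =
      alt_weight (2 * k + 3) 3 xs + 3 * length (frob xs)"
      using alt_weight_frob[OF x(2), of "2 * k + 3" 3]
        sum_odd_parts[OF is_partition_frob[OF x(2)], of "2 * k + 3" 3]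
      unfolding * by (simp only:)
    then have "sum_mset (image_mset (\<lambda>m. (2 * k + 6) * m - 3) (mset (frob xs))) =
      alt_weight (2 * k + 3) 3 xs"
      by (rule add_right_imp_eq)
    moreover have "sum_mset (image_mset (\<lambda>m. 2 * m) M) = 2 * sum_mset M"
      by (induction M) simp_all
    ultimately show ?thesis by (simp add: x)
  qed
  have "card {xs \<in> partitions n. cond_P k xs} =
    card {X. (0 \<notin># X \<and> (\<forall>p\<in>#X. P_part k p)) \<and> sum_mset X = n}"
    using card_partitions_mset[of n "\<lambda>X. \<forall>p\<in>#X. P_part k p"] by (simp add: cond_P_def)
  also have "\<dots> = card {x \<in> ?D. ?v x = n}"
    using card_fibre_bij_betw[OF bij, of sum_mset ?v n, OF weight] by simp
  also have "\<dots> = card {X. (0 \<notin># X \<and> C_mset k X) \<and> sum_mset X = n}"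
    using card_fibre_bij_betw[OF bij_betw_C_mset[of k], of sum_mset ?v n]
    by (auto simp: sum_alt_mset)
  also have "\<dots> = card {xs \<in> partitions n. cond_C k xs}"
    by (simp add: card_partitions_mset cond_C_iff_C_mset)
  finally show ?thesis .
qed

lemma card_cond_S_eq_cond_C:
  "card {xs \<in> partitions n. cond_S k xs} = card {xs \<in> partitions n. cond_C k xs}"
proof -
  have "bij_betw conjugate {xs \<in> partitions n. cond_S k xs} {xs \<in> partitions n. cond_C k xs}"
  proof (rule bij_betw_subset[OF bij_betw_conjugate[of n]])
    have cond: "cond_S k xs \<longleftrightarrow> cond_C k (conjugate xs)" if "xs \<in> partitions n" for xs
      using that cond_S_iff_cond_C by (simp add: partitions_def)
    have "conjugate ` {xs \<in> partitions n. cond_C k (conjugate xs)} =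
        {ys \<in> conjugate ` partitions n. cond_C k ys}"
      by auto
    also have "conjugate ` partitions n = partitions n"
      using bij_betw_conjugate by (rule bij_betw_imp_surj_on)
    finally show "conjugate ` {xs \<in> partitions n. cond_S k xs} = {xs \<in> partitions n. cond_C k xs}"
      using cond by (simp cong: conj_cong)
  qed simp
  then show ?thesis by (rule bij_betw_same_card)
qed

theorem mainTheorem7:
  fixes k :: nat
  assumes "k \<ge> 1"
  shows "(\<forall>n. card {xs \<in> partitions n. cond_P k xs} = card {xs \<in> partitions n. cond_S k xs})
    \<and> (\<forall>xs. is_partition xs \<longrightarrow> S_adjacency k xs \<longrightarrow>
          (S_initial k xs \<longleftrightarrow> S_adjacency k (xs @ [0])))
    \<and> (\<lambda>m. if m \<ge> 1 \<and> P_part k m then inverse (1 - fps_X ^ m) else 1) has_prod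
          (Abs_fps (\<lambda>n. of_nat (card {xs \<in> partitions n. cond_P k xs})) :: rat fps)
    \<and> (\<forall>m. P_part k (m + (2 * k + 6)) \<longleftrightarrow> P_part k m)
    \<and> (\<forall>xs. is_partition xs \<longrightarrow> (cond_S k xs \<longleftrightarrow> cond_C k (conjugate xs)))"
proof (intro conjI allI impI)
  show "card {xs \<in> partitions n. cond_P k xs} = card {xs \<in> partitions n. cond_S k xs}" for n
    by (simp add: card_cond_P_eq_cond_C card_cond_S_eq_cond_C)
  show "S_initial k xs \<longleftrightarrow> S_adjacency k (xs @ [0])"
    if "is_partition xs" "S_adjacency k xs" for xs
    using that by (simp add: S_adjacency_append_zero cond_S_def)
  show "(\<lambda>m. if m \<ge> 1 \<and> P_part k m then inverse (1 - fps_X ^ m) else 1) has_prod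
      (Abs_fps (\<lambda>n. of_nat (card {xs \<in> partitions n. cond_P k xs})) :: rat fps)"
    unfolding cond_P_def by (rule has_prod_partitions)
  show "P_part k (m + (2 * k + 6)) \<longleftrightarrow> P_part k m" for m
  proof -
    have "m + (2 * k + 6) + 3 = (m + 3) + (2 * k + 6)" by simp
    then have "(2 * k + 6) dvd (m + (2 * k + 6) + 3) \<longleftrightarrow> (2 * k + 6) dvd (m + 3)"
      by (simp only: dvd_add_triv_right_iff)
    then show ?thesis unfolding P_part_iff by simp
  qed
  show "cond_S k xs \<longleftrightarrow> cond_C k (conjugate xs)" if "is_partition xs" for xs
    by (rule cond_S_iff_cond_C[OF that])
qed

end
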